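(* Let $D\subset\mathbb R^d$ be open, $0<\alpha\le\beta$, $A\in\mathcal M_{\alpha,\beta}(D)$, let $x_0\in D$ be a Lebesgue point of $A$, and let $\xi\in\mathbb R^d$. For every $\rho>0$ with $B_\rho(x_0)\subset D$ let $u_\rho$ be the solution of $$-{\rm div}(A\nabla u_\rho)=0\ \text{in } B_\rho(x_0),\qquad u_\rho-\ell_\xi\in H^1_0(B_\rho(x_0)).$$ Then $$A(x_0)\xi=\lim_{\rho\to0}\frac1{|B_\rho|}\int_{B_\rho(x_0)}A\nabla u_\rho\,dx.$$
   Context: $\mathcal M_{\alpha,\beta}(D)$ is the family of measurable (not necessarily symmetric) $A:D\to\mathbb M^{d\times d}$ with $\alpha|\xi|^2\le\langle A(x)\xi,\xi\rangle$ and $|A(x)|\le\beta$ for a.e. $x\in D$ and all $\xi\in\mathbb R^d$. $\ell_\xi(x)=\langle\xi,x\rangle$. $B_\rho(x_0)$ is the open ball of radius $\rho$ centred at $x_0$. *)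

theory Defs
  imports "HOL-Analysis.Analysis"
begin

definition pderiv_i :: "'n::finite \<Rightarrow> (real^'n \<Rightarrow> real) \<Rightarrow> real^'n \<Rightarrow> real" where
  "pderiv_i i f x = frechet_derivative f (at x) (axis i 1)"

definition grad :: "(real^'n::finite \<Rightarrow> real) \<Rightarrow> real^'n \<Rightarrow> real^'n" where
  "grad f x = (\<chi> i. pderiv_i i f x)"

primrec Ck :: "nat \<Rightarrow> (real^'n::finite \<Rightarrow> real) \<Rightarrow> bool" where
  "Ck 0 f = continuous_on UNIV f"
| "Ck (Suc k) f = ((\<forall>x. f differentiable (at x)) \<and> continuous_on UNIV f \<and>
                   (\<forall>i. Ck k (pderiv_i i f)))"

definition smooth :: "(real^'n::finite \<Rightarrow> real) \<Rightarrow> bool" where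
  "smooth f \<longleftrightarrow> (\<forall>k. Ck k f)"

definition test_fun :: "(real^'n::finite) set \<Rightarrow> (real^'n \<Rightarrow> real) \<Rightarrow> bool" where
  "test_fun \<Omega> \<phi> \<longleftrightarrow> smooth \<phi> \<and> compact (closure {x. \<phi> x \<noteq> 0}) \<and> closure {x. \<phi> x \<noteq> 0} \<subseteq> \<Omega>"

definition has_weak_gradient ::
  "(real^'n::finite) set \<Rightarrow> (real^'n \<Rightarrow> real) \<Rightarrow> (real^'n \<Rightarrow> real^'n) \<Rightarrow> bool" where
  "has_weak_gradient \<Omega> u g \<longleftrightarrow>
     set_borel_measurable lebesgue \<Omega> u \<and> set_borel_measurable lebesgue \<Omega> g \<and>
     set_integrable lebesgue \<Omega> (\<lambda>x. (u x)^2) \<and>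
     set_integrable lebesgue \<Omega> (\<lambda>x. (norm (g x))^2) \<and>
     (\<forall>\<phi>. test_fun \<Omega> \<phi> \<longrightarrow> (\<forall>i.
        (LINT x:\<Omega>|lebesgue. u x * pderiv_i i \<phi> x) = - (LINT x:\<Omega>|lebesgue. g x $ i * \<phi> x)))"

definition in_H10 :: "(real^'n::finite) set \<Rightarrow> (real^'n \<Rightarrow> real) \<Rightarrow> bool" where
  "in_H10 \<Omega> u \<longleftrightarrow> (\<exists>g \<phi>s. has_weak_gradient \<Omega> u g \<and> (\<forall>k. test_fun \<Omega> (\<phi>s k)) \<and>
     (\<lambda>k. LINT x:\<Omega>|lebesgue. (\<phi>s k x - u x)^2 + (norm (grad (\<phi>s k) x - g x))^2)
        \<longlonglongrightarrow> 0)"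

text \<open>The class M_{\<alpha>,\<beta>}(D); |A(x)| is the operator norm.\<close>
definition elliptic_class :: "real \<Rightarrow> real \<Rightarrow> (real^'n::finite) set \<Rightarrow> (real^'n \<Rightarrow> real^'n^'n) set" where
  "elliptic_class \<alpha> \<beta> D = {A. set_borel_measurable lebesgue D A \<and>
     (AE x in lebesgue. x \<in> D \<longrightarrow>
        (\<forall>\<xi>. \<alpha> * (norm \<xi>)^2 \<le> inner (A x *v \<xi>) \<xi> \<and> norm (A x *v \<xi>) \<le> \<beta> * norm \<xi>))}"

definition lebesgue_point :: "(real^'n::finite \<Rightarrow> real^'n^'n) \<Rightarrow> real^'n \<Rightarrow> bool" where
  "lebesgue_point A x0 \<longleftrightarrow>
     ((\<lambda>\<rho>. (1 / measure lebesgue (ball x0 \<rho>)) * (LINT x:ball x0 \<rho>|lebesgue. norm (A x - A x0)))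
       \<longlongrightarrow> 0) (at_right 0)"

definition dirichlet_solution ::
  "(real^'n::finite \<Rightarrow> real^'n^'n) \<Rightarrow> (real^'n) set \<Rightarrow> real^'n \<Rightarrow> (real^'n \<Rightarrow> real) \<Rightarrow> (real^'n \<Rightarrow> real^'n) \<Rightarrow> bool" where
  "dirichlet_solution A \<Omega> \<xi> u g \<longleftrightarrow>
     has_weak_gradient \<Omega> u g \<and> in_H10 \<Omega> (\<lambda>x. u x - inner \<xi> x) \<and>
     (\<forall>\<phi>. test_fun \<Omega> \<phi> \<longrightarrow> (LINT x:\<Omega>|lebesgue. inner (A x *v g x) (grad \<phi> x)) = 0)"

end

theory Submission
  imports Defs "HOL-Computational_Algebra.Polynomial"
begin

text \<open>
  Let \<open>B\<close> be the ball of radius \<open>\<rho>\<close> and write \<open>g\<close> for the gradient of the solution. Then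
  \<open>g = \<xi> + h\<close>, where \<open>h\<close> is an \<open>L\<^sup>2\<close> limit of gradients of test functions, so \<open>h\<close> has mean zero
  and \<open>A g\<close> is orthogonal to \<open>h\<close>. The first fact gives that the mean of \<open>A g\<close> minus \<open>A(x0) \<xi>\<close> equals
  the mean of \<open>(A - A(x0)) g\<close>; the second bounds the mean of \<open>|g|\<^sup>2\<close> by \<open>(\<beta>/\<alpha>)\<^sup>2 |\<xi>|\<^sup>2\<close>
  uniformly in \<open>\<rho>\<close>. As \<open>A\<close> is bounded, \<open>|A - A(x0)|\<^sup>2 \<le> C |A - A(x0)|\<close>, whose mean tends to
  zero at a Lebesgue point, and a weighted AM-GM inequality concludes.
\<close>

section \<open>Smooth bump functions\<close>

lemma pderiv_i_eq:
  assumes "(f has_derivative f') (at x)"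
  shows "pderiv_i i f x = f' (axis i 1)"
  using frechet_derivative_at[OF assms] by (simp add: pderiv_i_def)

lemma Ck_Suc_imp_Ck: "Ck (Suc k) f \<Longrightarrow> Ck k f"
proof (induction k arbitrary: f)
  case (Suc k)
  have "Ck k (pderiv_i i f)" for i
    using Suc.prems by (intro Suc.IH) simp
  then show ?case
    using Suc.prems by simp
qed simp

lemma Ck_const: "Ck k (\<lambda>x. c)"
proof (induction k arbitrary: c)
  case (Suc k)
  have "pderiv_i i (\<lambda>x. c) = (\<lambda>x. 0)" for i :: 'a
    by (rule ext) (simp add: pderiv_i_eq[OF has_derivative_const])
  then show ?case
    by (simp add: Suc.IH)
qed simp

lemma Ck_add:
  "Ck k f \<Longrightarrow> Ck k g \<Longrightarrow> Ck k (\<lambda>x. f x + g x)"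
proof (induction k arbitrary: f g)
  case (Suc k)
  have d: "(f has_derivative frechet_derivative f (at x)) (at x)"
    "(g has_derivative frechet_derivative g (at x)) (at x)" for x
    using Suc.prems by (auto simp: frechet_derivative_works)
  have "pderiv_i i (\<lambda>x. f x + g x) = (\<lambda>x. pderiv_i i f x + pderiv_i i g x)" for i
    by (rule ext) (subst pderiv_i_eq[OF has_derivative_add[OF d]], simp add: pderiv_i_def)
  moreover have "Ck k (\<lambda>x. pderiv_i i f x + pderiv_i i g x)" for i
    using Suc.prems by (intro Suc.IH) auto
  ultimately show ?case
    using Suc.prems by (auto intro: continuous_intros)
qed (auto intro: continuous_intros)

lemma pderiv_i_mult:
  assumes "f differentiable (at x)" "g differentiable (at x)"
  shows "pderiv_i i (\<lambda>x. f x * g x) x = f x * pderiv_i i g x + pderiv_i i f x * g x"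
proof -
  have d: "(f has_derivative frechet_derivative f (at x)) (at x)"
    "(g has_derivative frechet_derivative g (at x)) (at x)"
    using assms by (auto simp: frechet_derivative_works)
  show ?thesis
    by (subst pderiv_i_eq[OF has_derivative_mult[OF d]], simp add: pderiv_i_def)
qed

lemma Ck_mult:
  "Ck k f \<Longrightarrow> Ck k g \<Longrightarrow> Ck k (\<lambda>x. f x * g x)"
proof (induction k arbitrary: f g)
  case (Suc k)
  have "pderiv_i i (\<lambda>x. f x * g x) = (\<lambda>x. f x * pderiv_i i g x + pderiv_i i f x * g x)" for i
    using Suc.prems by (intro ext pderiv_i_mult) auto
  \<comment> \<open>The product rule leaves \<open>f\<close> and \<open>g\<close> undifferentiated
    in one term each. They are known to be \<open>Ck (Suc k)\<close>, so they are first lowered to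
    \<open>Ck k\<close> to fit the induction hypothesis.\<close>
  moreover have "Ck k (\<lambda>x. f x * pderiv_i i g x + pderiv_i i f x * g x)" for i
    using Suc.prems Ck_Suc_imp_Ck[of k f] Ck_Suc_imp_Ck[of k g] by (intro Ck_add Suc.IH) auto
  ultimately show ?case
    using Suc.prems by (auto intro: continuous_intros)
qed (auto intro: continuous_intros)

lemma Ck_prod: "(\<And>i. i \<in> I \<Longrightarrow> Ck k (f i)) \<Longrightarrow> Ck k (\<lambda>x. \<Prod>i\<in>I. f i x)"
  by (induction I rule: infinite_finite_induct) (auto intro: Ck_const Ck_mult)

text \<open>For \<open>p = 1\<close> this is the classical function exp(-1/t), extended by zero to t
  \<le> 0. Carrying a polynomial in 1/t makes the family closed under differentiation.\<close>

definition flat :: "real poly \<Rightarrow> real \<Rightarrow> real" where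
  "flat p t = (if t \<le> 0 then 0 else poly p (1 / t) * exp (- (1 / t)))"

lemma poly_times_exp_minus_tendsto_0:
  fixes p :: "real poly"
  shows "((\<lambda>y. poly p y * exp (- y)) \<longlongrightarrow> 0) at_top"
proof -
  have "((\<lambda>y. \<Sum>i\<le>degree p. coeff p i * (y ^ i / exp y)) \<longlongrightarrow> (\<Sum>i\<le>degree p. coeff p i * 0)) at_top"
    by (intro tendsto_intros tendsto_power_div_exp_0)
  then show ?thesis
    by (simp add: poly_altdef exp_minus sum_distrib_right divide_inverse mult.assoc)
qed

text \<open>For t > 0 the derivative of p(1/t) exp(-1/t) is (1/t^2) (p - p')(1/t) exp(-1/t), and the
  factor 1/t^2 is the polynomial \<open>[:0, 0, 1:]\<close> in 1/t. At t = 0 exponential decay beats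
  every power of 1/t.\<close>

lemma flat_has_real_derivative:
  "(flat p has_real_derivative flat ([:0, 0, 1:] * (p - pderiv p)) t) (at t)"
proof -
  consider "t < 0" | "t = 0" | "t > 0" by linarith
  then show ?thesis
  proof cases
    case 1
    have "((\<lambda>t. 0) has_real_derivative 0) (at t)" by simp
    then have "(flat p has_real_derivative 0) (at t)"
      by (rule has_field_derivative_transform_within_open[where S="{..<0}"]) (use 1 in \<open>auto simp: flat_def\<close>)
    then show ?thesis using 1 by (simp add: flat_def)
  next
    case 2
    \<comment> \<open>Substitute y = 1/h. The division by h is one more factor y, which
      \<open>pCons 0 p\<close> absorbs.\<close>
    have "((\<lambda>h. flat p h / h) \<longlongrightarrow> 0) (at_right 0)"
    proof -
      have "((\<lambda>h. poly (pCons 0 p) (inverse h) * exp (- inverse h)) \<longlongrightarrow> 0) (at_right 0)"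
        by (rule filterlim_compose[OF poly_times_exp_minus_tendsto_0 filterlim_inverse_at_top_right])
      then show ?thesis
        by (rule Lim_transform_eventually)
          (auto simp: eventually_at_filter flat_def divide_inverse mult_ac)
    qed
    moreover have "((\<lambda>h. flat p h / h) \<longlongrightarrow> 0) (at_left 0)"
      by (rule Lim_transform_eventually[OF tendsto_const])
        (auto simp: eventually_at_filter flat_def)
    ultimately have "((\<lambda>h. flat p h / h) \<longlongrightarrow> 0) (at 0)"
      using filterlim_split_at by blast
    then show ?thesis using 2
      by (simp add: DERIV_def flat_def)
  next
    case 3
    have "((\<lambda>t. poly p (1 / t) * exp (- (1 / t))) has_real_derivative
        poly p (1 / t) * (exp (- (1 / t)) * (1 / t\<^sup>2)) + poly (pderiv p) (1 / t) * (- (1 / t\<^sup>2)) * exp (- (1 / t))) (at t)"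
      using 3 by (auto intro!: derivative_eq_intros DERIV_chain2[OF poly_DERIV] simp: power2_eq_square divide_simps)
    then have "(flat p has_real_derivative
        poly p (1 / t) * (exp (- (1 / t)) * (1 / t\<^sup>2)) + poly (pderiv p) (1 / t) * (- (1 / t\<^sup>2)) * exp (- (1 / t))) (at t)"
      by (rule has_field_derivative_transform_within_open[where S="{0<..}"]) (use 3 in \<open>auto simp: flat_def\<close>)
    then show ?thesis using 3
      by (simp add: flat_def power2_eq_square algebra_simps diff_divide_distrib)
  qed
qed

text \<open>Each partial derivative is a constant times a function of the same shape with another
  polynomial, so the induction on \<open>k\<close> keeps \<open>p\<close> arbitrary.\<close>

lemma Ck_flat_affine:
  fixes i :: "'n::finite"
  shows "Ck k (\<lambda>x::real^'n. flat p (c * x $ i + d))"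
proof (induction k arbitrary: p)
  case 0
  have "continuous_on UNIV (flat p)"
    by (meson DERIV_continuous continuous_at_imp_continuous_on flat_has_real_derivative)
  then show ?case
    by (auto intro: continuous_on_compose2 intro!: continuous_intros)
next
  case (Suc k)
  define q where "q = [:0, 0, 1:] * (p - pderiv p)"
  have lin: "((\<lambda>x::real^'n. c * x $ i + d) has_derivative (\<lambda>h. c * h $ i)) (at x)" for x
    by (auto intro!: derivative_eq_intros bounded_linear_imp_has_derivative[OF bounded_linear_vec_nth])
  have d: "((\<lambda>x::real^'n. flat p (c * x $ i + d)) has_derivative (\<lambda>h. (c * h $ i) * flat q (c * x $ i + d))) (at x)" for x
    using DERIV_compose_FDERIV[OF flat_has_real_derivative lin] by (simp add: q_def)
  have "pderiv_i j (\<lambda>x. flat p (c * x $ i + d)) = (\<lambda>x. c * axis j 1 $ i * flat q (c * x $ i + d))" for j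
    by (rule ext) (rule pderiv_i_eq[OF d])
  moreover have "Ck k (\<lambda>x. c * axis j 1 $ i * flat q (c * x $ i + d))" for j :: 'n
    by (intro Ck_mult Ck_const Suc.IH)
  moreover have "(\<lambda>x. flat p (c * x $ i + d)) differentiable (at x)" for x
    using d differentiable_def by blast
  ultimately show ?case
    by (auto intro!: continuous_at_imp_continuous_on differentiable_imp_continuous_within)
qed

text \<open>The factors are \<open>flat 1\<close> at m (x_i - a_i) and at m (b_i - x_i), expanded so
  that each argument has the affine form of \<open>Ck_flat_affine\<close>. The parameter
  \<open>m\<close> is a steepness: for large \<open>m\<close> the product approaches the indicator
  of the open box.\<close>

definition box_bump :: "real^'n::finite \<Rightarrow> real^'n \<Rightarrow> real \<Rightarrow> real^'n \<Rightarrow> real" where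
  "box_bump a b m x = (\<Prod>i\<in>UNIV. flat 1 (m * x $ i + - (m * a $ i)) * flat 1 (- m * x $ i + m * b $ i))"

lemma smooth_box_bump: "smooth (box_bump a b m)"
  unfolding smooth_def box_bump_def[abs_def]
  by (intro allI Ck_prod Ck_mult Ck_flat_affine)

lemma flat_1_nonneg: "0 \<le> flat 1 t" and flat_1_le_1: "flat 1 t \<le> 1"
  by (auto simp: flat_def)

lemma box_bump_bounds: "0 \<le> box_bump a b m x" "box_bump a b m x \<le> 1"
  unfolding box_bump_def
  by (auto intro!: prod_nonneg prod_le_1 mult_nonneg_nonneg mult_le_one flat_1_nonneg flat_1_le_1)

lemma box_bump_eq_0:
  assumes "m > 0" "x \<notin> box a b"
  shows "box_bump a b m x = 0"
proof -
  obtain i where "x $ i \<le> a $ i \<or> b $ i \<le> x $ i"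
    using assms(2) by (auto simp: mem_box_cart not_less)
  then have "flat 1 (m * x $ i + - (m * a $ i)) * flat 1 (- m * x $ i + m * b $ i) = 0"
    using assms(1) by (auto simp: flat_def)
  then show ?thesis
    unfolding box_bump_def by (intro prod_zero) auto
qed

lemma test_fun_box_bump:
  assumes "m > 0" "cbox a b \<subseteq> \<Omega>"
  shows "test_fun \<Omega> (box_bump a b m)"
proof -
  have "{x. box_bump a b m x \<noteq> 0} \<subseteq> cbox a b"
    using box_bump_eq_0[OF assms(1)] box_subset_cbox by blast
  then have *: "closure {x. box_bump a b m x \<noteq> 0} \<subseteq> cbox a b"
    by (intro closure_minimal closed_cbox)
  then have "compact (closure {x. box_bump a b m x \<noteq> 0})"
    by (meson bounded_cbox bounded_subset closed_closure compact_eq_bounded_closed)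
  with * assms(2) show ?thesis
    by (auto simp: test_fun_def smooth_box_bump)
qed

lemma flat_1_tendsto_1:
  assumes "t > 0"
  shows "(\<lambda>k. flat 1 (real (Suc k) * t)) \<longlonglongrightarrow> 1"
proof -
  have "(\<lambda>k. exp (- (inverse (real (Suc k)) * (1 / t)))) \<longlonglongrightarrow> exp (- (0 * (1 / t)))"
    by (intro tendsto_intros LIMSEQ_inverse_real_of_nat)
  moreover have "flat 1 (real (Suc k) * t) = exp (- (inverse (real (Suc k)) * (1 / t)))" for k
    using assms mult_pos_pos[of "real (Suc k)" t] by (simp add: flat_def divide_inverse not_le del: of_nat_Suc)
  ultimately show ?thesis
    by simp
qed

text \<open>Inside the box every factor is exp(-1/s) with s growing linearly, hence tends to 1.
  Outside, one factor vanishes for every steepness.\<close>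

lemma box_bump_tendsto_indicator:
  "(\<lambda>k. box_bump a b (real (Suc k)) x) \<longlonglongrightarrow> indicator (box a b) x"
proof (cases "x \<in> box a b")
  case True
  have "(\<lambda>k. \<Prod>i\<in>UNIV. flat 1 (real (Suc k) * (x $ i - a $ i)) * flat 1 (real (Suc k) * (b $ i - x $ i)))
     \<longlonglongrightarrow> (\<Prod>i\<in>(UNIV::'a set). 1 * 1)"
    using True by (intro tendsto_intros flat_1_tendsto_1) (auto simp: mem_box_cart)
  then show ?thesis
    using True by (simp add: box_bump_def[abs_def] algebra_simps)
next
  case False
  then show ?thesis
    by (simp add: box_bump_eq_0)
qed

section \<open>Functions annihilated by test functions\<close>

lemma set_lebesgue_lebesgue_on:
  fixes f :: "'a::euclidean_space \<Rightarrow> 'b::{banach, second_countable_topology}"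
  assumes "\<Omega> \<in> sets lebesgue"
  shows "set_borel_measurable lebesgue \<Omega> f \<longleftrightarrow> f \<in> borel_measurable (lebesgue_on \<Omega>)"
    and "set_integrable lebesgue \<Omega> f \<longleftrightarrow> integrable (lebesgue_on \<Omega>) f"
    and "set_lebesgue_integral lebesgue \<Omega> f = integral\<^sup>L (lebesgue_on \<Omega>) f"
  using assms
  by (simp_all add: set_borel_measurable_def set_integrable_def set_lebesgue_integral_def
      borel_measurable_restrict_space_iff integrable_restrict_space integral_restrict_space)

text \<open>The bumps are test functions with values in [0, 1] converging pointwise to the
  indicator, so dominated convergence with majorant |f| carries the hypothesis over to
  boxes.\<close>

lemma integral_box_eq_0_if_test_fun:
  fixes f :: "real^'n::finite \<Rightarrow> real"
  assumes "\<Omega> \<in> sets lebesgue" and f: "integrable (lebesgue_on \<Omega>) f"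
    and 0: "\<And>\<phi>. test_fun \<Omega> \<phi> \<Longrightarrow> (\<integral>x. f x * \<phi> x \<partial>lebesgue_on \<Omega>) = 0"
    and "cbox a b \<subseteq> \<Omega>"
  shows "(\<integral>x. f x * indicator (box a b) x \<partial>lebesgue_on \<Omega>) = 0"
proof -
  have meas: "box_bump a b m \<in> borel_measurable (lebesgue_on \<Omega>)" for m
  proof -
    have "continuous_on UNIV (box_bump a b m)"
      using smooth_box_bump[of a b m] unfolding smooth_def by (metis Ck.simps(1))
    then have "continuous_on \<Omega> (box_bump a b m)"
      by (rule continuous_on_subset) simp
    then show ?thesis
      using assms(1) by (rule continuous_imp_measurable_on_sets_lebesgue)
  qed
  have "(\<lambda>k. \<integral>x. f x * box_bump a b (real (Suc k)) x \<partial>lebesgue_on \<Omega>) \<longlonglongrightarrow>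
      (\<integral>x. f x * indicator (box a b) x \<partial>lebesgue_on \<Omega>)"
  proof (rule integral_dominated_convergence[where w="\<lambda>x. norm (f x)"])
    show "(\<lambda>x. f x * box_bump a b (real (Suc k)) x) \<in> borel_measurable (lebesgue_on \<Omega>)" for k
      using meas f by (intro borel_measurable_times) auto
    have "(indicat_real (box a b)) \<in> borel_measurable (lebesgue_on \<Omega>)"
      by (intro measurable_restrict_space1 borel_measurable_indicator) simp
    then show "(\<lambda>x. f x * indicator (box a b) x) \<in> borel_measurable (lebesgue_on \<Omega>)"
      using f by (intro borel_measurable_times) auto
    show "AE x in lebesgue_on \<Omega>. (\<lambda>k. f x * box_bump a b (real (Suc k)) x) \<longlonglongrightarrow> f x * indicator (box a b) x"
      by (intro AE_I2 tendsto_intros box_bump_tendsto_indicator)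
    show "AE x in lebesgue_on \<Omega>. norm (f x * box_bump a b (real (Suc k)) x) \<le> norm (f x)" for k
      using box_bump_bounds[of a b "real (Suc k)"]
      by (intro AE_I2) (auto simp: abs_mult intro!: mult_right_le_one_le)
  qed (use f in auto)
  moreover have "(\<integral>x. f x * box_bump a b (real (Suc k)) x \<partial>lebesgue_on \<Omega>) = 0" for k
    by (intro 0 test_fun_box_bump assms) simp
  ultimately show ?thesis
    by (simp add: LIMSEQ_const_iff)
qed

text \<open>The fundamental lemma of the calculus of variations: integrals of \<open>f\<close> over
  small cubes vanish, and almost every value of \<open>f\<close> is a limit of averages over such
  cubes.\<close>

lemma AE_eq_0_if_test_fun:
  fixes f :: "real^'n::finite \<Rightarrow> real"
  assumes \<Omega>: "open \<Omega>" and f: "integrable (lebesgue_on \<Omega>) f"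
    and 0: "\<And>\<phi>. test_fun \<Omega> \<phi> \<Longrightarrow> (\<integral>x. f x * \<phi> x \<partial>lebesgue_on \<Omega>) = 0"
  shows "AE x in lebesgue_on \<Omega>. f x = 0"
proof -
  have sets: "\<Omega> \<in> sets lebesgue"
    using \<Omega> by auto
  \<comment> \<open>Extension by zero, so that differentiation of the integral can be used on the
    whole space.\<close>
  define F where "F x = (if x \<in> \<Omega> then f x else 0)" for x
  have F: "integrable lebesgue F"
    unfolding F_def using Lebesgue_Measure.integrable_restrict_UNIV[OF sets, of f] f by blast
  then have "F integrable_on cbox a b" for a b
    by (intro integrable_on_subcbox[OF integrable_on_lebesgue] subset_UNIV)
  \<comment> \<open>Lebesgue differentiation along cubes that have x as their lowest corner.\<close>
  then obtain N where N: "negligible N"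
    and lim: "\<And>x e. \<lbrakk>x \<notin> N; 0 < e\<rbrakk> \<Longrightarrow> \<exists>d>0. \<forall>h. 0 < h \<and> h < d \<longrightarrow>
                norm (integral (cbox x (x + h *\<^sub>R One)) F /\<^sub>R h ^ DIM(real^'n) - F x) < e"
    by (rule integrable_ccontinuous_explicit) (rule that)
  have int0: "integral (cbox a b) F = 0" if "cbox a b \<subseteq> \<Omega>" for a b
  proof -
    have "integral (cbox a b) F = integral (box a b) F"
      by (simp add: integral_open_interval)
    also have "\<dots> = (LINT x:box a b|lebesgue. F x)"
      by (intro set_lebesgue_integral_eq_integral(2)[symmetric])
        (use integrable_mult_indicator[OF _ F, of "box a b"] in \<open>simp add: set_integrable_def\<close>)
    also have "\<dots> = (\<integral>x. f x * indicator (box a b) x \<partial>lebesgue_on \<Omega>)"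
      using sets by (simp add: set_lebesgue_integral_def integral_restrict_space)
         (intro Bochner_Integration.integral_cong, auto simp: F_def indicator_def)
    also have "\<dots> = 0"
      by (rule integral_box_eq_0_if_test_fun[OF sets f 0 that])
    finally show ?thesis .
  qed
  have "f x = 0" if "x \<in> \<Omega>" "x \<notin> N" for x
  proof -
    obtain r where r: "r > 0" "ball x r \<subseteq> \<Omega>"
      using \<Omega> \<open>x \<in> \<Omega>\<close> open_contains_ball by blast
    have "\<bar>F x\<bar> < e" if "e > 0" for e
    proof -
      obtain d where d: "d > 0" "\<And>h. 0 < h \<Longrightarrow> h < d \<Longrightarrow>
          norm (integral (cbox x (x + h *\<^sub>R One)) F /\<^sub>R h ^ DIM(real^'n) - F x) < e"
        using lim[OF \<open>x \<notin> N\<close> \<open>e > 0\<close>] by blast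
      have One: "norm (One::real^'n) > 0"
        by simp
      \<comment> \<open>The first bound puts the side length in the range of the differentiation
        estimate; the second makes the diagonal \<open>h * norm One\<close> shorter than
        \<open>r\<close>, so the cube stays in the ball.\<close>
      define h where "h = min (d / 2) (r / (2 * norm (One::real^'n)))"
      have h: "0 < h" "h < d" "h * norm (One::real^'n) < r"
        using d(1) r(1) One by (auto simp: h_def min_def field_simps)
      have "cbox x (x + h *\<^sub>R One) \<subseteq> ball x r"
      proof
        fix y assume y: "y \<in> cbox x (x + h *\<^sub>R One)"
        have "norm (y - x) \<le> norm (h *\<^sub>R (One::real^'n))"
          using y by (intro norm_le_componentwise) (auto simp: mem_box inner_simps)
        then show "y \<in> ball x r"
          using h by (simp add: dist_norm norm_minus_commute)
      qed
      then have "integral (cbox x (x + h *\<^sub>R One)) F = 0"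
        using r int0 by blast
      then show ?thesis
        using d(2)[OF h(1,2)] by simp
    qed
    \<comment> \<open>A nonzero value would allow e = |F x|, which gives |F x| < |F x|.\<close>
    from this[of "\<bar>F x\<bar>"] show ?thesis
      using that by (auto simp: F_def)
  qed
  moreover have "AE x in lebesgue. x \<notin> N"
    using N by (simp add: AE_not_in negligible_iff_null_sets)
  ultimately have "AE x in lebesgue. x \<in> \<Omega> \<longrightarrow> f x = 0"
    by (elim eventually_mono) blast
  then show ?thesis
    using sets by (simp add: AE_restrict_space_iff)
qed

section \<open>Integration by parts against test functions\<close>

lemma pderiv_i_eq_0:
  assumes "open U" "x \<in> U" "\<And>y. y \<in> U \<Longrightarrow> f y = 0"
  shows "pderiv_i i f x = 0"
proof -
  have "(f has_derivative (\<lambda>_. 0)) (at x)"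
    by (rule has_derivative_transform_within_open[OF has_derivative_const[of 0] assms(1,2)])
      (simp add: assms(3))
  then show ?thesis
    by (simp add: pderiv_i_eq)
qed

lemma continuous_bounded_support_bound:
  fixes f :: "'a::euclidean_space \<Rightarrow> 'b::real_normed_vector"
  assumes "continuous_on UNIV f" "\<And>x. x \<notin> cball 0 R \<Longrightarrow> f x = 0"
  obtains C where "C \<ge> 0" "\<And>x. norm (f x) \<le> C"
proof -
  have "compact (f ` cball 0 R)"
    by (intro compact_continuous_image continuous_on_subset[OF assms(1)]) auto
  then obtain C where C: "C > 0" "\<And>x. x \<in> cball 0 R \<Longrightarrow> norm (f x) \<le> C"
    by (metis bounded_pos compact_imp_bounded imageI)
  show thesis
    by (rule that[of C]) (use C assms(2) in \<open>metis less_imp_le norm_zero\<close>)+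
qed

text \<open>Difference quotients of an integrable function have integral zero by translation
  invariance of Lebesgue measure. Here they converge to the partial derivative under a common
  integrable majorant.\<close>

lemma integral_pderiv_i_eq_0:
  fixes f :: "real^'n::finite \<Rightarrow> real"
  assumes f: "Ck (Suc 0) f" and supp: "\<And>x. x \<notin> cball 0 R \<Longrightarrow> f x = 0"
  shows "(\<integral>x. pderiv_i i f x \<partial>lborel) = 0"
proof -
  have cont: "continuous_on UNIV f" "continuous_on UNIV (pderiv_i i f)"
    and diff: "\<And>x. f differentiable (at x)"
    using f by auto
  have supp': "pderiv_i i f x = 0" if "x \<notin> cball 0 R" for x
    by (rule pderiv_i_eq_0[of "- cball 0 R"]) (use that supp in auto)
  obtain C where C: "C \<ge> 0" "\<And>x. norm (pderiv_i i f x) \<le> C"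
    using continuous_bounded_support_bound[OF cont(2) supp'] by blast
  define e :: "real^'n" where "e = axis i 1"
  have ne: "norm e = 1"
    by (simp add: e_def)
  have line: "((\<lambda>s. f (x + s *\<^sub>R e)) has_real_derivative pderiv_i i f (x + s *\<^sub>R e)) (at s)" for x s
  proof -
    have "((\<lambda>s. x + s *\<^sub>R e) has_derivative (\<lambda>h. h *\<^sub>R e)) (at s)"
      by (auto intro!: derivative_eq_intros)
    moreover have D: "(f has_derivative frechet_derivative f (at (x + s *\<^sub>R e))) (at (x + s *\<^sub>R e))"
      using diff frechet_derivative_works by blast
    ultimately have "((\<lambda>s. f (x + s *\<^sub>R e)) has_derivative (\<lambda>h. frechet_derivative f (at (x + s *\<^sub>R e)) (h *\<^sub>R e))) (at s)"
      by (rule has_derivative_compose)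
    moreover have "frechet_derivative f (at (x + s *\<^sub>R e)) (h *\<^sub>R e) = pderiv_i i f (x + s *\<^sub>R e) * h" for h
      using linear_scale[OF has_derivative_linear[OF D]] by (simp add: pderiv_i_def e_def)
    ultimately show ?thesis
      by (simp add: has_field_derivative_def)
  qed
  define t where "t n = inverse (real (Suc n))" for n
  have t: "0 < t n" "t n \<le> 1" for n
    by (auto simp: t_def field_simps)
  define F where "F n x = (f (x + t n *\<^sub>R e) - f x) / t n" for n x
  \<comment> \<open>By the mean value theorem a quotient is a value of the derivative, hence at most
    \<open>C\<close>. Since the shift has length at most 1, a quotient can be nonzero only within
    radius R + 1.\<close>
  have F_bound: "norm (F n x) \<le> C * indicator (cball 0 (R + 1)) x" for n x
  proof (cases "x \<in> cball 0 (R + 1)")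
    case True
    obtain z where "f (x + t n *\<^sub>R e) - f (x + 0 *\<^sub>R e) = (t n - 0) * pderiv_i i f (x + z *\<^sub>R e)"
      using MVT2[OF t(1)[of n], of "\<lambda>s. f (x + s *\<^sub>R e)" "\<lambda>s. pderiv_i i f (x + s *\<^sub>R e)"] line by blast
    then have "F n x = pderiv_i i f (x + z *\<^sub>R e)"
      using t(1)[of n] by (simp add: F_def)
    then show ?thesis
      using True C by simp
  next
    case False
    have "norm (t n *\<^sub>R e) \<le> 1"
      using t[of n] ne by simp
    then have "x \<notin> cball 0 R" "x + t n *\<^sub>R e \<notin> cball 0 R"
      using False norm_diff_ineq[of x "t n *\<^sub>R e"] by auto
    then show ?thesis
      using False supp by (simp add: F_def)
  qed
  have mf: "f \<in> borel_measurable borel"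
    by (intro borel_measurable_continuous_onI cont)
  have "(\<lambda>n. integral\<^sup>L lborel (F n)) \<longlonglongrightarrow> (\<integral>x. pderiv_i i f x \<partial>lborel)"
  proof (rule integral_dominated_convergence[where w="\<lambda>x. C * indicator (cball 0 (R + 1)) x"])
    show "pderiv_i i f \<in> borel_measurable lborel"
      using borel_measurable_continuous_onI[OF cont(2)] by simp
    show "F n \<in> borel_measurable lborel" for n
      unfolding F_def[abs_def] using mf by measurable
    show "integrable lborel (\<lambda>x::real^'n. C * indicator (cball 0 (R + 1)) x)"
      by (intro integrable_mult_right integrable_real_indicator emeasure_lborel_cball_finite) auto
    show "AE x in lborel. norm (F n x) \<le> C * indicator (cball 0 (R + 1)) x" for n
      using F_bound by simp
    show "AE x in lborel. (\<lambda>n. F n x) \<longlonglongrightarrow> pderiv_i i f x"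
    proof (rule AE_I2)
      fix x :: "real^'n"
      have "((\<lambda>h. (f (x + (0 + h) *\<^sub>R e) - f (x + 0 *\<^sub>R e)) / h) \<longlongrightarrow> pderiv_i i f (x + 0 *\<^sub>R e)) (at 0)"
        using line[of x 0] by (simp add: DERIV_def)
      moreover have "filterlim t (at 0) sequentially"
      proof (rule filterlim_atI)
        show "t \<longlonglongrightarrow> 0"
          unfolding t_def by (rule LIMSEQ_inverse_real_of_nat)
        show "\<forall>\<^sub>F n in sequentially. t n \<noteq> 0"
          using t(1) by (simp add: less_imp_neq[symmetric])
      qed
      ultimately show "(\<lambda>n. F n x) \<longlonglongrightarrow> pderiv_i i f x"
        using filterlim_compose by (fastforce simp: F_def)
    qed
  qed
  \<comment> \<open>Both terms of the quotient have the same integral, because \<open>lborel\<close>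
    is invariant under the shift by \<open>t n *\<^sub>R e\<close>.\<close>
  moreover have "integral\<^sup>L lborel (F n) = 0" for n
  proof -
    obtain B where B: "B \<ge> 0" "\<And>x. norm (f x) \<le> B"
      using continuous_bounded_support_bound[OF cont(1) supp] by blast
    have int: "integrable lborel f"
    proof (rule Bochner_Integration.integrable_bound)
      show "integrable lborel (\<lambda>x::real^'n. B * indicator (cball 0 R) x)"
        by (intro integrable_mult_right integrable_real_indicator emeasure_lborel_cball_finite) auto
      show "AE x in lborel. norm (f x) \<le> norm (B * indicat_real (cball 0 R) x)"
        using B supp by (auto simp: indicator_def)
    qed (use mf in simp)
    have shift: "distr lborel lborel ((+) (t n *\<^sub>R e)) = lborel"
      using lborel_distr_plus[of "t n *\<^sub>R e"]
      by (metis distr_cong sets_lborel)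
    have "integrable lborel (\<lambda>x. f (t n *\<^sub>R e + x))"
      by (rule integrable_distr[of _ lborel lborel]) (use shift int in auto)
    moreover have "(\<integral>x. f (t n *\<^sub>R e + x) \<partial>lborel) = integral\<^sup>L lborel f"
      using integral_distr[of "(+) (t n *\<^sub>R e)" lborel lborel f] shift mf by simp
    ultimately show ?thesis
      unfolding F_def using int by (simp add: add.commute)
  qed
  ultimately show ?thesis
    by (simp add: LIMSEQ_const_iff)
qed

lemma test_funD:
  assumes "test_fun \<Omega> \<phi>"
  shows "Ck k \<phi>" and "\<phi> differentiable (at x)" and "continuous_on UNIV \<phi>"
    and "continuous_on UNIV (pderiv_i i \<phi>)"
    and "x \<notin> \<Omega> \<Longrightarrow> \<phi> x = 0" and "x \<notin> \<Omega> \<Longrightarrow> pderiv_i i \<phi> x = 0"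
proof -
  show Ck: "Ck k \<phi>" for k
    using assms by (simp add: test_fun_def smooth_def)
  show "\<phi> differentiable (at x)" "continuous_on UNIV \<phi>" "continuous_on UNIV (pderiv_i i \<phi>)"
    using Ck[of "Suc 0"] by auto
  let ?K = "closure {x. \<phi> x \<noteq> 0}"
  have out: "\<phi> y = 0" if "y \<notin> ?K" for y
    using that closure_subset[of "{x. \<phi> x \<noteq> 0}"] by blast
  assume "x \<notin> \<Omega>"
  then have x: "x \<in> - ?K"
    using assms by (auto simp: test_fun_def)
  then show "\<phi> x = 0"
    using out by blast
  show "pderiv_i i \<phi> x = 0"
    by (rule pderiv_i_eq_0[OF open_Compl[OF closed_closure] x]) (use out in blast)
qed

lemma test_fun_bounded_support:
  assumes "test_fun \<Omega> \<phi>"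
  obtains R where "\<And>x. x \<notin> cball 0 R \<Longrightarrow> \<phi> x = 0" "\<And>x i. x \<notin> cball 0 R \<Longrightarrow> pderiv_i i \<phi> x = 0"
proof -
  have "bounded (closure {x. \<phi> x \<noteq> 0})"
    using assms by (auto simp: test_fun_def compact_imp_bounded)
  then obtain R where R: "closure {x. \<phi> x \<noteq> 0} \<subseteq> cball 0 R"
    using bounded_subset_ballD[of _ 0] ball_subset_cball by (meson order_trans)
  then have supp: "\<phi> x = 0" if "x \<notin> cball 0 R" for x
    using that closure_subset[of "{x. \<phi> x \<noteq> 0}"] by blast
  show thesis
  proof (rule that[of R])
    show "pderiv_i i \<phi> x = 0" if "x \<notin> cball 0 R" for x i
      by (rule pderiv_i_eq_0[of "- cball 0 R"]) (use that supp in auto)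
  qed (rule supp)
qed

lemma grad_continuous_bounded:
  assumes "test_fun \<Omega> \<phi>"
  shows "continuous_on UNIV (grad \<phi>)" and "\<exists>C. \<forall>x. norm (grad \<phi> x) \<le> C"
proof -
  show cont: "continuous_on UNIV (grad \<phi>)"
    unfolding grad_def by (intro continuous_on_vec_lambda test_funD(4)[OF assms])
  obtain R where "\<And>x i. x \<notin> cball 0 R \<Longrightarrow> pderiv_i i \<phi> x = 0"
    using test_fun_bounded_support[OF assms] by metis
  then have "grad \<phi> x = 0" if "x \<notin> cball 0 R" for x
    using that by (simp add: grad_def vec_eq_iff)
  then obtain C where "\<And>x. norm (grad \<phi> x) \<le> C"
    using continuous_bounded_support_bound[OF cont] by blast
  then show "\<exists>C. \<forall>x. norm (grad \<phi> x) \<le> C"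
    by blast
qed

text \<open>The restriction changes nothing because \<open>f\<close> vanishes off the set, and
  completing the measure does not change integrals of Borel functions.\<close>

lemma integral_lebesgue_on_eq_lborel:
  fixes f :: "'a::euclidean_space \<Rightarrow> real"
  assumes "\<Omega> \<in> sets lebesgue" "f \<in> borel_measurable borel" "\<And>x. x \<notin> \<Omega> \<Longrightarrow> f x = 0"
  shows "integral\<^sup>L (lebesgue_on \<Omega>) f = integral\<^sup>L lborel f"
proof -
  have "integral\<^sup>L (lebesgue_on \<Omega>) f = integral\<^sup>L lebesgue (\<lambda>x. indicator \<Omega> x *\<^sub>R f x)"
    using assms by (intro integral_restrict_space) simp
  also have "(\<lambda>x. indicator \<Omega> x *\<^sub>R f x) = f"
    using assms(3) by (auto simp: fun_eq_iff indicator_def)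
  also have "integral\<^sup>L lebesgue f = integral\<^sup>L lborel f"
    using assms(2) by (intro integral_completion) simp
  finally show ?thesis .
qed

lemma integral_pderiv_i_test_fun:
  assumes "\<Omega> \<in> sets lebesgue" and \<phi>: "test_fun \<Omega> \<phi>"
  shows "(\<integral>x. pderiv_i i \<phi> x \<partial>lebesgue_on \<Omega>) = 0"
proof -
  obtain R where R: "\<And>x. x \<notin> cball 0 R \<Longrightarrow> \<phi> x = 0"
    using test_fun_bounded_support[OF \<phi>] by metis
  have "(\<integral>x. pderiv_i i \<phi> x \<partial>lebesgue_on \<Omega>) = (\<integral>x. pderiv_i i \<phi> x \<partial>lborel)"
    using test_funD[OF \<phi>]
    by (intro integral_lebesgue_on_eq_lborel assms borel_measurable_continuous_onI)
  also have "\<dots> = 0"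
    by (rule integral_pderiv_i_eq_0[OF test_funD(1)[OF \<phi>] R])
  finally show ?thesis .
qed

lemma Ck_inner: "Ck k (\<lambda>x. inner \<xi> x)"
proof (cases k)
  case (Suc m)
  have d: "((\<lambda>x. inner \<xi> x) has_derivative (\<lambda>h. inner \<xi> h)) (at x)" for x
    by (auto intro!: derivative_eq_intros)
  have "pderiv_i i (\<lambda>x. inner \<xi> x) = (\<lambda>x. \<xi> $ i)" for i
    by (rule ext) (subst pderiv_i_eq[OF d], simp add: inner_axis)
  then show ?thesis
    using Suc d by (auto simp: Ck_const differentiable_def intro: continuous_intros)
qed (auto intro: continuous_intros)

lemma pderiv_i_inner: "pderiv_i i (\<lambda>x. inner \<xi> x) x = \<xi> $ i"
proof -
  have "((\<lambda>x. inner \<xi> x) has_derivative (\<lambda>h. inner \<xi> h)) (at x)"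
    by (auto intro!: derivative_eq_intros)
  from pderiv_i_eq[OF this] show ?thesis
    by (simp add: inner_axis)
qed

text \<open>The constant field \<open>\<xi>\<close> is the gradient of the linear boundary datum in
  the weak sense. The product of this datum with a test function has bounded support, so its partial
  derivative integrates to zero, and the product rule splits that integral.\<close>

lemma integral_inner_pderiv_i_test_fun:
  assumes \<Omega>: "\<Omega> \<in> sets lebesgue" and \<phi>: "test_fun \<Omega> \<phi>"
  shows "(\<integral>x. inner \<xi> x * pderiv_i i \<phi> x \<partial>lebesgue_on \<Omega>) = - (\<integral>x. \<xi> $ i * \<phi> x \<partial>lebesgue_on \<Omega>)"
proof -
  obtain R where R: "\<And>x. x \<notin> cball 0 R \<Longrightarrow> \<phi> x = 0" "\<And>x i. x \<notin> cball 0 R \<Longrightarrow> pderiv_i i \<phi> x = 0"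
    using test_fun_bounded_support[OF \<phi>] by metis
  note D = test_funD[OF \<phi>]
  have integrable: "integrable lborel h"
    if cont: "continuous_on UNIV h" and supp: "\<And>x. x \<notin> cball 0 R \<Longrightarrow> h x = 0" for h :: "real^'a \<Rightarrow> real"
  proof -
    have "integrable lborel (\<lambda>x. indicator (cball 0 R) x *\<^sub>R h x)"
      by (intro borel_integrable_compact continuous_on_subset[OF cont]) auto
    also have "(\<lambda>x. indicator (cball 0 R) x *\<^sub>R h x) = h"
      using supp by (auto simp: fun_eq_iff indicator_def)
    finally show ?thesis .
  qed
  have "0 = (\<integral>x. pderiv_i i (\<lambda>x. inner \<xi> x * \<phi> x) x \<partial>lborel)"
    by (rule integral_pderiv_i_eq_0[where R=R, symmetric, OF Ck_mult[OF Ck_inner D(1)]])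
      (simp add: R del: mem_cball)
  also have "pderiv_i i (\<lambda>x. inner \<xi> x * \<phi> x) = (\<lambda>x. inner \<xi> x * pderiv_i i \<phi> x + \<xi> $ i * \<phi> x)"
    using D(2) Ck_inner[of "Suc 0" \<xi>] by (auto simp: pderiv_i_mult pderiv_i_inner)
  also have "(\<integral>x. inner \<xi> x * pderiv_i i \<phi> x + \<xi> $ i * \<phi> x \<partial>lborel) =
      (\<integral>x. inner \<xi> x * pderiv_i i \<phi> x \<partial>lborel) + (\<integral>x. \<xi> $ i * \<phi> x \<partial>lborel)"
    by (intro Bochner_Integration.integral_add integrable continuous_intros D) (simp_all add: R del: mem_cball)
  also have "(\<integral>x. inner \<xi> x * pderiv_i i \<phi> x \<partial>lborel) = (\<integral>x. inner \<xi> x * pderiv_i i \<phi> x \<partial>lebesgue_on \<Omega>)"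
    by (intro integral_lebesgue_on_eq_lborel[symmetric] \<Omega> borel_measurable_continuous_onI continuous_intros D)
      (simp add: D(6))
  also have "(\<integral>x. \<xi> $ i * \<phi> x \<partial>lborel) = (\<integral>x. \<xi> $ i * \<phi> x \<partial>lebesgue_on \<Omega>)"
    by (intro integral_lebesgue_on_eq_lborel[symmetric] \<Omega> borel_measurable_continuous_onI continuous_intros D)
      (simp add: D(5))
  finally show ?thesis
    by simp
qed

section \<open>Square integrable functions\<close>

text \<open>Young's inequality, from the nonnegativity of (t a - b)^2 / (2t). The free weight
  \<open>t\<close> later serves both to absorb a term and to pass to limits.\<close>

lemma mult_le_weighted_squares:
  fixes a b t :: real
  assumes "t > 0"
  shows "a * b \<le> t / 2 * a\<^sup>2 + 1 / (2 * t) * b\<^sup>2"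
proof -
  have "0 \<le> (t * a - b)\<^sup>2 / (2 * t)"
    using assms by simp
  also have "\<dots> = t / 2 * a\<^sup>2 + 1 / (2 * t) * b\<^sup>2 - a * b"
    using assms by (simp add: power2_eq_square field_simps)
  finally show ?thesis
    by simp
qed

definition square_integrable :: "'a measure \<Rightarrow> ('a \<Rightarrow> 'b::euclidean_space) \<Rightarrow> bool" where
  "square_integrable M f \<longleftrightarrow> f \<in> borel_measurable M \<and> integrable M (\<lambda>x. (norm (f x))\<^sup>2)"

lemma square_integrableD:
  assumes "square_integrable M f"
  shows "f \<in> borel_measurable M" "integrable M (\<lambda>x. (norm (f x))\<^sup>2)"
  using assms by (auto simp: square_integrable_def)

lemma square_integrable_bound:
  fixes f :: "'a \<Rightarrow> 'b::euclidean_space" and g :: "'a \<Rightarrow> 'c::euclidean_space"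
  assumes f: "square_integrable M f" and g[measurable]: "g \<in> borel_measurable M"
    and le: "AE x in M. norm (g x) \<le> C * norm (f x)"
  shows "square_integrable M g"
proof -
  have "integrable M (\<lambda>x. C\<^sup>2 * (norm (f x))\<^sup>2)"
    using square_integrableD(2)[OF f] by simp
  then have "integrable M (\<lambda>x. (norm (g x))\<^sup>2)"
  proof (rule Bochner_Integration.integrable_bound)
    show "AE x in M. norm ((norm (g x))\<^sup>2) \<le> norm (C\<^sup>2 * (norm (f x))\<^sup>2)"
      using le
    proof eventually_elim
      case (elim x)
      then have "(norm (g x))\<^sup>2 \<le> (C * norm (f x))\<^sup>2"
        by (intro power_mono) auto
      then show ?case
        by (simp add: power_mult_distrib)
    qed
  qed simp
  with g show ?thesis
    by (simp add: square_integrable_def)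
qed

lemma square_integrable_diff:
  assumes f: "square_integrable M f" and g: "square_integrable M g"
  shows "square_integrable M (\<lambda>x. f x - g x)"
proof -
  have [measurable]: "f \<in> borel_measurable M" "g \<in> borel_measurable M"
    using assms by (auto dest: square_integrableD)
  have "integrable M (\<lambda>x. 2 * (norm (f x))\<^sup>2 + 2 * (norm (g x))\<^sup>2)"
    using square_integrableD(2)[OF f] square_integrableD(2)[OF g] by simp
  then have "integrable M (\<lambda>x. (norm (f x - g x))\<^sup>2)"
  proof (rule Bochner_Integration.integrable_bound)
    have "(norm (f x - g x))\<^sup>2 \<le> 2 * (norm (f x))\<^sup>2 + 2 * (norm (g x))\<^sup>2" for x
    proof -
      have "(norm (f x - g x))\<^sup>2 \<le> (norm (f x) + norm (g x))\<^sup>2"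
        by (intro power_mono norm_triangle_ineq4) simp
      also have "\<dots> \<le> 2 * (norm (f x))\<^sup>2 + 2 * (norm (g x))\<^sup>2"
        using mult_le_weighted_squares[of 1 "norm (f x)" "norm (g x)"] by (simp add: power2_sum)
      finally show ?thesis .
    qed
    then show "AE x in M. norm ((norm (f x - g x))\<^sup>2) \<le> norm (2 * (norm (f x))\<^sup>2 + 2 * (norm (g x))\<^sup>2)"
      by auto
  qed simp
  then show ?thesis
    by (simp add: square_integrable_def)
qed

lemma square_integrable_const: "finite_measure M \<Longrightarrow> square_integrable M (\<lambda>_. c)"
  by (simp add: square_integrable_def finite_measure.integrable_const)

lemma square_integrable_vec_nth:
  fixes f :: "'a \<Rightarrow> real^'n::finite"
  assumes "square_integrable M f"
  shows "square_integrable M (\<lambda>x. f x $ i)"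
proof (rule square_integrable_bound[OF assms])
  show "(\<lambda>x. f x $ i) \<in> borel_measurable M"
    by (rule borel_measurable_continuous_on[OF _ square_integrableD(1)[OF assms]])
      (intro continuous_intros)
  show "AE x in M. norm (f x $ i) \<le> 1 * norm (f x)"
    by (simp add: component_le_norm_cart)
qed

text \<open>A form of Cauchy-Schwarz with a free weight, obtained by integrating Young's inequality;
  each application picks its own \<open>t\<close>.\<close>

lemma square_integrable_pairing:
  fixes f :: "'a \<Rightarrow> 'b::euclidean_space" and g :: "'a \<Rightarrow> 'c::euclidean_space"
  assumes f: "square_integrable M f" and g: "square_integrable M g"
  shows "integrable M (\<lambda>x. norm (f x) * norm (g x))"
    and "t > 0 \<Longrightarrow> (\<integral>x. norm (f x) * norm (g x) \<partial>M) \<le>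
           t / 2 * (\<integral>x. (norm (f x))\<^sup>2 \<partial>M) + 1 / (2 * t) * (\<integral>x. (norm (g x))\<^sup>2 \<partial>M)"
proof -
  have [measurable]: "f \<in> borel_measurable M" "g \<in> borel_measurable M"
    using assms by (auto dest: square_integrableD)
  note int = square_integrableD(2)[OF f] square_integrableD(2)[OF g]
  have int': "integrable M (\<lambda>x. s / 2 * (norm (f x))\<^sup>2 + 1 / (2 * s) * (norm (g x))\<^sup>2)" for s
    using int by (intro Bochner_Integration.integrable_add integrable_mult_right)
  show fg: "integrable M (\<lambda>x. norm (f x) * norm (g x))"
    by (rule Bochner_Integration.integrable_bound[OF int'[of 1]])
      (use mult_le_weighted_squares[of 1] in auto)
  assume t: "t > 0"
  have "(\<integral>x. norm (f x) * norm (g x) \<partial>M) \<le> (\<integral>x. t / 2 * (norm (f x))\<^sup>2 + 1 / (2 * t) * (norm (g x))\<^sup>2 \<partial>M)"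
    by (intro integral_mono fg int' mult_le_weighted_squares t)
  also have "\<dots> = t / 2 * (\<integral>x. (norm (f x))\<^sup>2 \<partial>M) + 1 / (2 * t) * (\<integral>x. (norm (g x))\<^sup>2 \<partial>M)"
    using int by simp
  finally show "(\<integral>x. norm (f x) * norm (g x) \<partial>M) \<le>
           t / 2 * (\<integral>x. (norm (f x))\<^sup>2 \<partial>M) + 1 / (2 * t) * (\<integral>x. (norm (g x))\<^sup>2 \<partial>M)" .
qed

lemma square_integrable_imp_integrable:
  assumes "finite_measure M" "square_integrable M f"
  shows "integrable M f"
proof (rule Bochner_Integration.integrable_bound)
  show "integrable M (\<lambda>x. norm (f x) * norm (1::real))"
    by (rule square_integrable_pairing(1)[OF assms(2) square_integrable_const[OF assms(1)]])
qed (use square_integrableD[OF assms(2)] in auto)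

lemma square_integrable_inner:
  assumes f: "square_integrable M f" and g: "square_integrable M g"
  shows "integrable M (\<lambda>x. inner (f x) (g x))"
    and "\<bar>\<integral>x. inner (f x) (g x) \<partial>M\<bar> \<le> (\<integral>x. norm (f x) * norm (g x) \<partial>M)"
proof -
  have [measurable]: "f \<in> borel_measurable M" "g \<in> borel_measurable M"
    using assms by (auto dest: square_integrableD)
  note fg = square_integrable_pairing(1)[OF assms]
  show i: "integrable M (\<lambda>x. inner (f x) (g x))"
    by (rule Bochner_Integration.integrable_bound[OF fg]) (auto simp: Cauchy_Schwarz_ineq2)
  have "\<bar>\<integral>x. inner (f x) (g x) \<partial>M\<bar> \<le> (\<integral>x. \<bar>inner (f x) (g x)\<bar> \<partial>M)"
    by (rule integral_abs_bound)
  also have "\<dots> \<le> (\<integral>x. norm (f x) * norm (g x) \<partial>M)"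
    using i by (intro integral_mono fg) (auto simp: Cauchy_Schwarz_ineq2)
  finally show "\<bar>\<integral>x. inner (f x) (g x) \<partial>M\<bar> \<le> (\<integral>x. norm (f x) * norm (g x) \<partial>M)" .
qed

text \<open>First fix \<open>t\<close> small enough to make the first term at most e/2; for that
  \<open>t\<close> the second term tends to zero along \<open>F\<close>.\<close>

lemma tendsto_0_if_weighted_bound:
  fixes X Y :: "'a \<Rightarrow> real"
  assumes bound: "\<And>t. t > 0 \<Longrightarrow> \<forall>\<^sub>F k in F. \<bar>X k\<bar> \<le> t * a + c * Y k / t"
    and Y: "(Y \<longlongrightarrow> 0) F"
  shows "(X \<longlongrightarrow> 0) F"
proof (rule tendstoI)
  fix e :: real assume e: "e > 0"
  \<comment> \<open>Adding 1 keeps the denominator positive when \<open>a\<close> is zero.\<close>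
  define t where "t = e / (2 * (\<bar>a\<bar> + 1))"
  have t: "t > 0"
    using e by (simp add: t_def)
  have "t * a \<le> t * (\<bar>a\<bar> + 1)"
    using t by (intro mult_left_mono) auto
  also have "\<dots> = e / 2"
    using e by (simp add: t_def field_simps add_eq_0_iff)
  finally have ta: "t * a \<le> e / 2" .
  have "((\<lambda>k. c * Y k / t) \<longlongrightarrow> c * 0 / t) F"
    by (intro tendsto_intros Y) (use t in auto)
  then have "\<forall>\<^sub>F k in F. c * Y k / t < e / 2"
    by (rule order_tendstoD) (use e in simp)
  with bound[OF t] show "\<forall>\<^sub>F k in F. dist (X k) 0 < e"
    unfolding dist_real_def diff_zero by eventually_elim (use ta in linarith)
qed

text \<open>Strong convergence to zero in L^2 implies weak convergence to zero.\<close>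

lemma square_integrable_inner_tendsto_0:
  assumes f: "square_integrable M f" and v: "\<And>k. square_integrable M (v k)"
    and lim: "(\<lambda>k. \<integral>x. (norm (v k x))\<^sup>2 \<partial>M) \<longlonglongrightarrow> 0"
  shows "(\<lambda>k. \<integral>x. inner (f x) (v k x) \<partial>M) \<longlonglongrightarrow> 0"
proof (rule tendsto_0_if_weighted_bound[OF _ lim])
  fix t :: real assume t: "t > 0"
  show "\<forall>\<^sub>F k in sequentially. \<bar>\<integral>x. inner (f x) (v k x) \<partial>M\<bar> \<le>
      t * (1 / 2 * (\<integral>x. (norm (f x))\<^sup>2 \<partial>M)) + 1 / 2 * (\<integral>x. (norm (v k x))\<^sup>2 \<partial>M) / t"
  proof (intro always_eventually allI)
    fix k
    show "\<bar>\<integral>x. inner (f x) (v k x) \<partial>M\<bar> \<le>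
      t * (1 / 2 * (\<integral>x. (norm (f x))\<^sup>2 \<partial>M)) + 1 / 2 * (\<integral>x. (norm (v k x))\<^sup>2 \<partial>M) / t"
      using square_integrable_inner(2)[OF f v[of k]] square_integrable_pairing(2)[OF f v[of k] t]
      by simp
  qed
qed

lemma continuous_bounded_square_integrable:
  fixes f :: "'a::euclidean_space \<Rightarrow> 'b::euclidean_space"
  assumes "\<Omega> \<in> lmeasurable" "continuous_on \<Omega> f" "\<And>x. x \<in> \<Omega> \<Longrightarrow> norm (f x) \<le> C"
  shows "square_integrable (lebesgue_on \<Omega>) f"
proof (rule square_integrable_bound[OF square_integrable_const[of _ "1::real"]])
  show "finite_measure (lebesgue_on \<Omega>)"
    by (rule finite_measure_lebesgue_on[OF assms(1)])
  show "f \<in> borel_measurable (lebesgue_on \<Omega>)"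
    using assms by (intro continuous_imp_measurable_on_sets_lebesgue) auto
  show "AE x in lebesgue_on \<Omega>. norm (f x) \<le> C * norm (1::real)"
    using assms(3) by (intro AE_I2) simp
qed

lemma test_fun_square_integrable:
  assumes \<Omega>: "\<Omega> \<in> lmeasurable" and \<phi>: "test_fun \<Omega> \<phi>"
  shows "square_integrable (lebesgue_on \<Omega>) \<phi>"
    and "square_integrable (lebesgue_on \<Omega>) (pderiv_i i \<phi>)"
    and "square_integrable (lebesgue_on \<Omega>) (grad \<phi>)"
proof -
  obtain R where R: "\<And>x. x \<notin> cball 0 R \<Longrightarrow> \<phi> x = 0"
    using test_fun_bounded_support[OF \<phi>] by metis
  obtain C where "\<And>x. norm (\<phi> x) \<le> C"
    using continuous_bounded_support_bound[OF test_funD(3)[OF \<phi>] R] by blast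
  then show "square_integrable (lebesgue_on \<Omega>) \<phi>"
    by (intro continuous_bounded_square_integrable[OF \<Omega>] continuous_on_subset[OF test_funD(3)[OF \<phi>]]) auto
  obtain C where "\<And>x. norm (grad \<phi> x) \<le> C"
    using grad_continuous_bounded(2)[OF \<phi>] by blast
  then show grad: "square_integrable (lebesgue_on \<Omega>) (grad \<phi>)"
    by (intro continuous_bounded_square_integrable[OF \<Omega>]
        continuous_on_subset[OF grad_continuous_bounded(1)[OF \<phi>]]) auto
  show "square_integrable (lebesgue_on \<Omega>) (pderiv_i i \<phi>)"
    using square_integrable_vec_nth[OF grad, of i] by (simp add: grad_def)
qed

section \<open>Weak gradients and the energy estimate\<close>

lemma norm_matrix_vector_mult_le:
  fixes A :: "real^'n::finite^'m::finite"
  shows "norm (A *v x) \<le> norm A * norm x"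
proof -
  have "norm (A *v x) = L2_set (\<lambda>i. norm ((A *v x) $ i)) UNIV"
    by (simp add: norm_vec_def)
  also have "\<dots> \<le> L2_set (\<lambda>i. norm (A $ i) * norm x) UNIV"
    by (intro L2_set_mono) (auto simp: matrix_vector_mul_component Cauchy_Schwarz_ineq2)
  also have "\<dots> = norm A * norm x"
    by (simp add: norm_vec_def L2_set_left_distrib)
  finally show ?thesis .
qed

text \<open>Here \<open>norm\<close> is the Frobenius norm, whereas ellipticity bounds the operator
  norm. Applying the matrix to \<open>axis j 1\<close> bounds every entry by \<open>\<beta>\<close>,
  and summing entries gives a crude constant depending only on the dimensions and
  \<open>\<beta>\<close>.\<close>

lemma norm_matrix_le:
  fixes A :: "real^'n::finite^'m::finite" and \<beta> :: real
  assumes "\<And>\<xi>. norm (A *v \<xi>) \<le> \<beta> * norm \<xi>"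
  shows "norm A \<le> real CARD('m) * (real CARD('n) * \<beta>)"
proof -
  have "\<bar>A $ i $ j\<bar> \<le> \<beta>" for i j
  proof -
    have "\<bar>A $ i $ j\<bar> = \<bar>(A *v axis j 1) $ i\<bar>"
      by (simp add: matrix_vector_mul_component inner_axis)
    also have "\<dots> \<le> norm (A *v axis j 1)"
      by (rule component_le_norm_cart)
    also have "\<dots> \<le> \<beta>"
      using assms[of "axis j 1"] by simp
    finally show ?thesis .
  qed
  then have "norm (A $ i) \<le> real CARD('n) * \<beta>" for i
    by (intro order_trans[OF norm_le_l1_cart] sum_bounded_above) auto
  then have "(\<Sum>i\<in>UNIV. norm (A $ i)) \<le> real CARD('m) * (real CARD('n) * \<beta>)"
    by (intro sum_bounded_above) auto
  moreover have "norm A \<le> (\<Sum>i\<in>UNIV. norm (A $ i))"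
    by (simp add: norm_vec_def L2_set_le_sum)
  ultimately show ?thesis
    by simp
qed

lemma borel_measurable_matrix_vector_mult:
  fixes A :: "'a \<Rightarrow> real^'n::finite^'m::finite"
  assumes "A \<in> borel_measurable M" "g \<in> borel_measurable M"
  shows "(\<lambda>x. A x *v g x) \<in> borel_measurable M"
  by (rule borel_measurable_continuous_Pair[OF assms])
    (auto simp: matrix_vector_mult_def intro!: continuous_intros)

lemma weak_gradient_square_integrable:
  assumes "\<Omega> \<in> sets lebesgue" "has_weak_gradient \<Omega> u g"
  shows "square_integrable (lebesgue_on \<Omega>) u" "square_integrable (lebesgue_on \<Omega>) g"
  using assms by (simp_all add: has_weak_gradient_def square_integrable_def set_lebesgue_lebesgue_on)

lemma weak_gradient_integral:
  assumes "\<Omega> \<in> sets lebesgue" "has_weak_gradient \<Omega> u g" "test_fun \<Omega> \<phi>"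
  shows "(\<integral>x. u x * pderiv_i i \<phi> x \<partial>lebesgue_on \<Omega>) = - (\<integral>x. g x $ i * \<phi> x \<partial>lebesgue_on \<Omega>)"
  using assms by (simp add: has_weak_gradient_def set_lebesgue_lebesgue_on)

text \<open>Uniqueness of weak gradients: both sides are weak gradients of \<open>u\<close>, so each
  component of their difference is annihilated by all test functions.\<close>

lemma weak_gradient_minus_linear:
  assumes \<Omega>: "open \<Omega>" "bounded \<Omega>"
    and g: "has_weak_gradient \<Omega> u g"
    and h: "has_weak_gradient \<Omega> (\<lambda>x. u x - inner \<xi> x) h"
  shows "AE x in lebesgue_on \<Omega>. g x = \<xi> + h x"
proof -
  have lm: "\<Omega> \<in> lmeasurable" and sets: "\<Omega> \<in> sets lebesgue"
    using \<Omega> by (auto intro: lmeasurable_open)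
  let ?M = "lebesgue_on \<Omega>"
  have fin: "finite_measure ?M"
    by (rule finite_measure_lebesgue_on[OF lm])
  note sg = weak_gradient_square_integrable[OF sets g]
  note sh = weak_gradient_square_integrable[OF sets h]
  have "AE x in ?M. g x $ i - \<xi> $ i - h x $ i = 0" for i
  proof (rule AE_eq_0_if_test_fun[OF \<Omega>(1)])
    have gi: "square_integrable ?M (\<lambda>x. g x $ i)" and hi: "square_integrable ?M (\<lambda>x. h x $ i)"
      and \<xi>i: "square_integrable ?M (\<lambda>x. \<xi> $ i)"
      using sg sh fin by (auto intro: square_integrable_vec_nth square_integrable_const)
    show "integrable ?M (\<lambda>x. g x $ i - \<xi> $ i - h x $ i)"
      by (intro square_integrable_imp_integrable[OF fin] square_integrable_diff gi hi \<xi>i)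
    fix \<phi> assume \<phi>: "test_fun \<Omega> \<phi>"
    note s\<phi> = test_fun_square_integrable[OF lm \<phi>]
    have mult: "integrable ?M (\<lambda>x. p x * q x)" if "square_integrable ?M p" "square_integrable ?M q"
      for p q :: "real^'a \<Rightarrow> real"
      using square_integrable_inner(1)[OF that] by simp
    \<comment> \<open>The linear function is square integrable as the difference of \<open>u\<close>
      and \<open>u\<close> minus the linear function.\<close>
    have "square_integrable ?M (\<lambda>x. u x - (u x - inner \<xi> x))"
      by (intro square_integrable_diff sg sh)
    then have lin: "square_integrable ?M (\<lambda>x. inner \<xi> x)"
      by simp
    have "(\<integral>x. (g x $ i - \<xi> $ i - h x $ i) * \<phi> x \<partial>?M) =
        (\<integral>x. g x $ i * \<phi> x - \<xi> $ i * \<phi> x - h x $ i * \<phi> x \<partial>?M)"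
      by (simp add: left_diff_distrib)
    also have "\<dots> = (\<integral>x. g x $ i * \<phi> x \<partial>?M) - (\<integral>x. \<xi> $ i * \<phi> x \<partial>?M) - (\<integral>x. h x $ i * \<phi> x \<partial>?M)"
      using mult[OF gi s\<phi>(1)] mult[OF hi s\<phi>(1)] mult[OF \<xi>i s\<phi>(1)]
      by (simp del: integral_mult_right_zero integrable_mult_right_iff)
    also have "\<dots> = - (\<integral>x. u x * pderiv_i i \<phi> x \<partial>?M) + (\<integral>x. inner \<xi> x * pderiv_i i \<phi> x \<partial>?M)
        + (\<integral>x. (u x - inner \<xi> x) * pderiv_i i \<phi> x \<partial>?M)"
      using weak_gradient_integral[OF sets g \<phi>] weak_gradient_integral[OF sets h \<phi>]
        integral_inner_pderiv_i_test_fun[OF sets \<phi>, of \<xi> i] by simp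
    also have "(\<integral>x. (u x - inner \<xi> x) * pderiv_i i \<phi> x \<partial>?M) =
        (\<integral>x. u x * pderiv_i i \<phi> x \<partial>?M) - (\<integral>x. inner \<xi> x * pderiv_i i \<phi> x \<partial>?M)"
      unfolding left_diff_distrib
      by (intro Bochner_Integration.integral_diff mult sg lin s\<phi>)
    finally show "(\<integral>x. (g x $ i - \<xi> $ i - h x $ i) * \<phi> x \<partial>?M) = 0"
      by simp
  qed
  then have "AE x in ?M. \<forall>i\<in>UNIV. g x $ i - \<xi> $ i - h x $ i = 0"
    by (intro AE_finite_allI) auto
  then show ?thesis
    by eventually_elim (simp add: vec_eq_iff algebra_simps)
qed

text \<open>Here \<open>h\<close> is the weak gradient of \<open>u\<close> minus the boundary datum.
  It is an L^2 limit of gradients of test functions and so inherits their orthogonality to constant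
  fields and to the flux \<open>A g\<close>; square integrability of the flux lets the limit pass
  through the pairing.\<close>

lemma dirichlet_solution_obtain:
  assumes \<Omega>: "open \<Omega>" "bounded \<Omega>" and sol: "dirichlet_solution A \<Omega> \<xi> u g"
    and sAg: "square_integrable (lebesgue_on \<Omega>) (\<lambda>x. A x *v g x)"
  obtains h where "square_integrable (lebesgue_on \<Omega>) h" "AE x in lebesgue_on \<Omega>. g x = \<xi> + h x"
    "(\<integral>x. h x \<partial>lebesgue_on \<Omega>) = 0" "(\<integral>x. inner (A x *v g x) (h x) \<partial>lebesgue_on \<Omega>) = 0"
proof -
  have lm: "\<Omega> \<in> lmeasurable" and sets: "\<Omega> \<in> sets lebesgue"
    using \<Omega> by (auto intro: lmeasurable_open)
  let ?M = "lebesgue_on \<Omega>"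
  have fin: "finite_measure ?M"
    by (rule finite_measure_lebesgue_on[OF lm])
  have g: "has_weak_gradient \<Omega> u g" and H10: "in_H10 \<Omega> (\<lambda>x. u x - inner \<xi> x)"
    and weak: "\<And>\<phi>. test_fun \<Omega> \<phi> \<Longrightarrow> (\<integral>x. inner (A x *v g x) (grad \<phi> x) \<partial>?M) = 0"
    using sol sets by (auto simp: dirichlet_solution_def set_lebesgue_lebesgue_on)
  obtain h \<phi> where h: "has_weak_gradient \<Omega> (\<lambda>x. u x - inner \<xi> x) h"
    and \<phi>: "\<And>k. test_fun \<Omega> (\<phi> k)"
    and lim: "(\<lambda>k. \<integral>x. (\<phi> k x - (u x - inner \<xi> x))\<^sup>2 + (norm (grad (\<phi> k) x - h x))\<^sup>2 \<partial>?M) \<longlonglongrightarrow> 0"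
    using H10 sets unfolding in_H10_def by (auto simp: set_lebesgue_lebesgue_on)
  note sh = weak_gradient_square_integrable[OF sets h]
  note s\<phi> = test_fun_square_integrable[OF lm \<phi>]
  define v where "v k x = grad (\<phi> k) x - h x" for k x
  have sv: "square_integrable ?M (v k)" for k
    unfolding v_def by (intro square_integrable_diff sh s\<phi>)
  \<comment> \<open>Dropping the zeroth-order term of the H^1 distance leaves convergence of the
    gradients alone.\<close>
  have lim_v: "(\<lambda>k. \<integral>x. (norm (v k x))\<^sup>2 \<partial>?M) \<longlonglongrightarrow> 0"
  proof (rule tendsto_sandwich[OF _ _ tendsto_const lim])
    have "(\<integral>x. (norm (v k x))\<^sup>2 \<partial>?M) \<le>
        (\<integral>x. (\<phi> k x - (u x - inner \<xi> x))\<^sup>2 + (norm (grad (\<phi> k) x - h x))\<^sup>2 \<partial>?M)" for k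
    proof (rule integral_mono)
      have "integrable ?M (\<lambda>x. (norm (\<phi> k x - (u x - inner \<xi> x)))\<^sup>2)"
        by (intro square_integrableD(2) square_integrable_diff[OF s\<phi>(1)] sh)
      then show "integrable ?M (\<lambda>x. (\<phi> k x - (u x - inner \<xi> x))\<^sup>2 + (norm (grad (\<phi> k) x - h x))\<^sup>2)"
        using square_integrableD(2)[OF sv[of k]] by (simp add: v_def)
    qed (use square_integrableD(2)[OF sv] in \<open>auto simp: v_def\<close>)
    then show "\<forall>\<^sub>F k in sequentially. (\<integral>x. (norm (v k x))\<^sup>2 \<partial>?M) \<le>
        (\<integral>x. (\<phi> k x - (u x - inner \<xi> x))\<^sup>2 + (norm (grad (\<phi> k) x - h x))\<^sup>2 \<partial>?M)"
      by simp
  qed simp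
  \<comment> \<open>If \<open>f\<close> is orthogonal to every \<open>grad (\<phi> k)\<close>, its
    pairing with \<open>v k\<close> is a constant sequence that also tends to zero.\<close>
  have orth: "(\<integral>x. inner (f x) (h x) \<partial>?M) = 0"
    if f: "square_integrable ?M f" and f0: "\<And>k. (\<integral>x. inner (f x) (grad (\<phi> k) x) \<partial>?M) = 0" for f
  proof -
    have "(\<integral>x. inner (f x) (v k x) \<partial>?M) = - (\<integral>x. inner (f x) (h x) \<partial>?M)" for k
      unfolding v_def inner_diff_right
      using f0[of k] square_integrable_inner(1)[OF f s\<phi>(3)[of k]] square_integrable_inner(1)[OF f sh(2)]
      by simp
    then show ?thesis
      using square_integrable_inner_tendsto_0[OF f sv lim_v] by (simp add: LIMSEQ_const_iff)
  qed
  have "(\<integral>x. h x \<partial>?M) $ i = 0" for i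
  proof -
    \<comment> \<open>Constant fields qualify for \<open>orth\<close> because partial derivatives of
      test functions integrate to zero; this yields each component of the mean of
      \<open>h\<close>.\<close>
    have "(\<integral>x. inner (axis i 1) (h x) \<partial>?M) = 0"
      by (rule orth[OF square_integrable_const[OF fin]])
        (simp add: inner_axis' grad_def integral_pderiv_i_test_fun[OF sets \<phi>])
    moreover have "(\<integral>x. inner (axis i 1) (h x) \<partial>?M) = inner (axis i 1) (\<integral>x. h x \<partial>?M)"
      by (intro integral_inner_right square_integrable_imp_integrable[OF fin sh(2)])
    ultimately show ?thesis
      by (simp add: inner_axis')
  qed
  then have "(\<integral>x. h x \<partial>?M) = 0"
    by (simp add: vec_eq_iff)
  moreover have "(\<integral>x. inner (A x *v g x) (h x) \<partial>?M) = 0"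
    by (rule orth[OF sAg weak[OF \<phi>]])
  ultimately show thesis
    using that sh(2) weak_gradient_minus_linear[OF \<Omega> g h] by blast
qed

text \<open>The mean of \<open>g\<close> is \<open>\<xi>\<close> because \<open>h\<close> has mean
  zero. For the energy, coercivity bounds \<alpha> times the integral of |g|^2 by that of <A g, g>;
  orthogonality of the flux to \<open>h\<close> replaces the second \<open>g\<close> by
  \<open>\<xi>\<close>, and Young's inequality absorbs what remains of \<open>g\<close>.\<close>

lemma dirichlet_solution_estimates:
  assumes \<Omega>: "open \<Omega>" "bounded \<Omega>" and sol: "dirichlet_solution A \<Omega> \<xi> u g"
    and A: "A \<in> borel_measurable (lebesgue_on \<Omega>)" and \<alpha>: "0 < \<alpha>" and \<beta>: "0 < \<beta>"
    and ell: "AE x in lebesgue_on \<Omega>. \<forall>\<xi>. \<alpha> * (norm \<xi>)\<^sup>2 \<le> inner (A x *v \<xi>) \<xi> \<and> norm (A x *v \<xi>) \<le> \<beta> * norm \<xi>"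
  shows "square_integrable (lebesgue_on \<Omega>) g"
    and "square_integrable (lebesgue_on \<Omega>) (\<lambda>x. A x *v g x)"
    and "(\<integral>x. g x \<partial>lebesgue_on \<Omega>) = measure lebesgue \<Omega> *\<^sub>R \<xi>"
    and "(\<integral>x. (norm (g x))\<^sup>2 \<partial>lebesgue_on \<Omega>) \<le> (\<beta> / \<alpha>)\<^sup>2 * (norm \<xi>)\<^sup>2 * measure lebesgue \<Omega>"
proof -
  have lm: "\<Omega> \<in> lmeasurable" and sets: "\<Omega> \<in> sets lebesgue"
    using \<Omega> by (auto intro: lmeasurable_open)
  let ?M = "lebesgue_on \<Omega>"
  have fin: "finite_measure ?M"
    by (rule finite_measure_lebesgue_on[OF lm])
  have meas: "measure ?M (space ?M) = measure lebesgue \<Omega>"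
    using sets by (simp add: measure_restrict_space)
  show sg: "square_integrable ?M g"
    using sol sets weak_gradient_square_integrable(2) by (auto simp: dirichlet_solution_def)
  show sAg: "square_integrable ?M (\<lambda>x. A x *v g x)"
    using ell by (intro square_integrable_bound[OF sg, of _ \<beta>] borel_measurable_matrix_vector_mult
        A square_integrableD(1)[OF sg]) (auto elim: eventually_mono)
  obtain h where sh: "square_integrable ?M h" and gh: "AE x in ?M. g x = \<xi> + h x"
    and h0: "(\<integral>x. h x \<partial>?M) = 0" and orth: "(\<integral>x. inner (A x *v g x) (h x) \<partial>?M) = 0"
    using dirichlet_solution_obtain[OF \<Omega> sol sAg] by blast
  have "(\<integral>x. g x \<partial>?M) = (\<integral>x. \<xi> + h x \<partial>?M)"
    using square_integrableD(1)[OF sg] square_integrableD(1)[OF sh] gh by (intro integral_cong_AE) auto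
  also have "\<dots> = (\<integral>x. \<xi> \<partial>?M) + (\<integral>x. h x \<partial>?M)"
    by (intro Bochner_Integration.integral_add square_integrable_imp_integrable[OF fin]
        square_integrable_const[OF fin] sh)
  finally show "(\<integral>x. g x \<partial>?M) = measure lebesgue \<Omega> *\<^sub>R \<xi>"
    using h0 meas by simp
  let ?G = "\<integral>x. (norm (g x))\<^sup>2 \<partial>?M"
  have s\<xi>: "square_integrable ?M (\<lambda>_. \<xi>)"
    by (rule square_integrable_const[OF fin])
  have "\<alpha> * ?G = (\<integral>x. \<alpha> * (norm (g x))\<^sup>2 \<partial>?M)"
    by simp
  also have "\<dots> \<le> (\<integral>x. inner (A x *v g x) (g x) \<partial>?M)"
    using ell square_integrableD(2)[OF sg]
    by (intro integral_mono_AE square_integrable_inner(1)[OF sAg sg]) (auto elim: eventually_mono)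
  also have "\<dots> = (\<integral>x. inner (A x *v g x) \<xi> + inner (A x *v g x) (h x) \<partial>?M)"
    using square_integrableD(1)[OF sg] square_integrableD(1)[OF sh] square_integrableD(1)[OF sAg] gh
    by (intro integral_cong_AE borel_measurable_add borel_measurable_inner)
      (auto elim!: eventually_mono simp: inner_add_right)
  also have "\<dots> = (\<integral>x. inner (A x *v g x) \<xi> \<partial>?M)"
    using square_integrable_inner(1)[OF sAg s\<xi>] square_integrable_inner(1)[OF sAg sh] orth by simp
  also have "\<dots> \<le> (\<integral>x. norm (A x *v g x) * norm \<xi> \<partial>?M)"
    using square_integrable_inner(2)[OF sAg s\<xi>] by linarith
  also have "\<dots> \<le> (\<integral>x. \<beta> * (norm (g x) * norm \<xi>) \<partial>?M)"
    using ell square_integrable_pairing(1)[OF sAg s\<xi>] square_integrable_pairing(1)[OF sg s\<xi>]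
    by (intro integral_mono_AE integrable_mult_right)
      (auto elim!: eventually_mono simp: mult.assoc[symmetric] intro!: mult_right_mono)
  also have "\<dots> = \<beta> * (\<integral>x. norm (g x) * norm \<xi> \<partial>?M)"
    by (rule integral_mult_right_zero)
  \<comment> \<open>The weight \<alpha> / \<beta> makes the coefficient of \<open>?G\<close> equal
    to \<alpha> / 2, half of the left-hand side, so it can be absorbed.\<close>
  also have "\<dots> \<le> \<beta> * ((\<alpha> / \<beta>) / 2 * ?G + 1 / (2 * (\<alpha> / \<beta>)) * (\<integral>x. (norm \<xi>)\<^sup>2 \<partial>?M))"
    using \<alpha> \<beta> by (intro mult_left_mono square_integrable_pairing(2)[OF sg s\<xi>]) auto
  also have "\<dots> = \<alpha> / 2 * ?G + \<beta>\<^sup>2 / (2 * \<alpha>) * ((norm \<xi>)\<^sup>2 * measure lebesgue \<Omega>)"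
    using \<alpha> \<beta> meas by (simp add: field_simps power2_eq_square)
  finally have "\<alpha> / 2 * ?G \<le> \<beta>\<^sup>2 / (2 * \<alpha>) * ((norm \<xi>)\<^sup>2 * measure lebesgue \<Omega>)"
    by simp
  then have "2 / \<alpha> * (\<alpha> / 2 * ?G) \<le> 2 / \<alpha> * (\<beta>\<^sup>2 / (2 * \<alpha>) * ((norm \<xi>)\<^sup>2 * measure lebesgue \<Omega>))"
    using \<alpha> by (intro mult_left_mono) auto
  then show "?G \<le> (\<beta> / \<alpha>)\<^sup>2 * (norm \<xi>)\<^sup>2 * measure lebesgue \<Omega>"
    using \<alpha> by (simp add: power2_eq_square)
qed

section \<open>Averaged fluxes on shrinking balls\<close>

theorem theorem8p3:
  fixes D :: "(real^'n::finite) set" and A :: "real^'n \<Rightarrow> real^'n^'n"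
    and \<alpha> \<beta> :: real and x0 \<xi> :: "real^'n"
    and u :: "real \<Rightarrow> real^'n \<Rightarrow> real" and Du :: "real \<Rightarrow> real^'n \<Rightarrow> real^'n"
  assumes "open D" and "0 < \<alpha>" and "\<alpha> \<le> \<beta>" and "A \<in> elliptic_class \<alpha> \<beta> D"
    and "x0 \<in> D" and "lebesgue_point A x0"
    and "\<And>\<rho>. \<rho> > 0 \<Longrightarrow> ball x0 \<rho> \<subseteq> D \<Longrightarrow> dirichlet_solution A (ball x0 \<rho>) \<xi> (u \<rho>) (Du \<rho>)"
  shows "((\<lambda>\<rho>. (1 / measure lebesgue (ball x0 \<rho>)) *\<^sub>R (LINT x:ball x0 \<rho>|lebesgue. A x *v Du \<rho> x))
           \<longlongrightarrow> A x0 *v \<xi>) (at_right 0)"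
proof -
  have \<beta>: "0 < \<beta>"
    using assms(2,3) by linarith
  obtain r where r: "r > 0" "ball x0 r \<subseteq> D"
    using assms(1,5) open_contains_ball by blast
  \<comment> \<open>An almost everywhere bound for |A - A(x0)| in the Frobenius norm. The value at
    the single point \<open>x0\<close> is not controlled by an almost everywhere bound, so its own
    norm is added.\<close>
  define C where "C = real CARD('n) * (real CARD('n) * \<beta>) + norm (A x0)"
  \<comment> \<open>The bound on the mean of |Du|^2 from the energy estimate, independent of the
    radius.\<close>
  define K where "K = (\<beta> / \<alpha>)\<^sup>2 * (norm \<xi>)\<^sup>2"
  define Y where "Y \<rho> = (1 / measure lebesgue (ball x0 \<rho>)) * (LINT x:ball x0 \<rho>|lebesgue. norm (A x - A x0))" for \<rho>
  define X where "X \<rho> = (1 / measure lebesgue (ball x0 \<rho>)) *\<^sub>R (LINT x:ball x0 \<rho>|lebesgue. A x *v Du \<rho> x)" for \<rho>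
  \<comment> \<open>The condition \<rho> < r keeps the ball inside \<open>D\<close>, where the
    solution and the ellipticity bounds are available. The constants \<open>K\<close> and
    \<open>C\<close> depend neither on \<rho> nor on \<open>t\<close>.\<close>
  have bound: "norm (X \<rho> - A x0 *v \<xi>) \<le> t * (K / 2) + C / 2 * Y \<rho> / t"
    if t: "t > 0" and \<rho>: "0 < \<rho>" "\<rho> < r" for t \<rho>
  proof -
    let ?B = "ball x0 \<rho>"
    let ?M = "lebesgue_on ?B"
    let ?m = "measure lebesgue ?B"
    let ?g = "Du \<rho>"
    have sub: "?B \<subseteq> D"
      using r(2) \<rho> by (meson less_imp_le order_trans subset_ball)
    have sets: "?B \<in> sets lebesgue"
      by simp
    have m: "?m > 0"
      using \<rho>(1) by (simp add: content_ball_pos)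
    have fin: "finite_measure ?M"
      by (rule finite_measure_lebesgue_on) simp
    have "set_borel_measurable lebesgue D A"
      using assms(4) by (simp add: elliptic_class_def)
    then have "set_borel_measurable lebesgue ?B A"
      by (rule set_borel_measurable_subset[OF _ sets sub])
    then have A: "A \<in> borel_measurable ?M"
      by (simp add: set_lebesgue_lebesgue_on)
    have "AE x in lebesgue. x \<in> D \<longrightarrow>
        (\<forall>\<xi>. \<alpha> * (norm \<xi>)\<^sup>2 \<le> inner (A x *v \<xi>) \<xi> \<and> norm (A x *v \<xi>) \<le> \<beta> * norm \<xi>)"
      using assms(4) by (simp add: elliptic_class_def)
    then have "AE x in lebesgue. x \<in> ?B \<longrightarrow>
        (\<forall>\<xi>. \<alpha> * (norm \<xi>)\<^sup>2 \<le> inner (A x *v \<xi>) \<xi> \<and> norm (A x *v \<xi>) \<le> \<beta> * norm \<xi>)"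
      by eventually_elim (use sub in blast)
    then have ell: "AE x in ?M. \<forall>\<xi>. \<alpha> * (norm \<xi>)\<^sup>2 \<le> inner (A x *v \<xi>) \<xi> \<and> norm (A x *v \<xi>) \<le> \<beta> * norm \<xi>"
      by (simp add: AE_restrict_space_iff del: mem_ball)
    note est = dirichlet_solution_estimates[OF open_ball bounded_ball assms(7)[OF \<rho>(1) sub] A assms(2) \<beta> ell]
    have [measurable]: "(\<lambda>x. A x - A x0) \<in> borel_measurable ?M"
      using A by (intro borel_measurable_diff) auto
    have AC: "AE x in ?M. norm (A x - A x0) \<le> C"
      using ell
    proof eventually_elim
      case (elim x)
      then have "norm (A x) \<le> real CARD('n) * (real CARD('n) * \<beta>)"
        by (intro norm_matrix_le) blast
      then show ?case
        unfolding C_def by (intro order_trans[OF norm_triangle_ineq4]) simp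
    qed
    have sA: "square_integrable ?M (\<lambda>x. A x - A x0)"
      by (rule square_integrable_bound[OF square_integrable_const[OF fin, of "1::real"]]) (use AC in auto)
    have sAg0: "square_integrable ?M (\<lambda>x. A x0 *v ?g x)"
      by (rule square_integrable_bound[OF est(1), of _ "norm (A x0)"])
        (auto intro: borel_measurable_matrix_vector_mult square_integrableD(1)[OF est(1)] norm_matrix_vector_mult_le)
    have "(\<integral>x. A x0 *v ?g x \<partial>?M) = A x0 *v (\<integral>x. ?g x \<partial>?M)"
      by (intro integral_bounded_linear square_integrable_imp_integrable[OF fin est(1)]
          linear_conv_bounded_linear[THEN iffD1] matrix_vector_mul_linear)
    also have "\<dots> = ?m *\<^sub>R (A x0 *v \<xi>)"
      by (simp add: est(3) matrix_vector_mult_scaleR)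
    finally have "(1 / ?m) *\<^sub>R (\<integral>x. A x0 *v ?g x \<partial>?M) = A x0 *v \<xi>"
      using m by simp
    then have "X \<rho> - A x0 *v \<xi> = (1 / ?m) *\<^sub>R ((\<integral>x. A x *v ?g x \<partial>?M) - (\<integral>x. A x0 *v ?g x \<partial>?M))"
      by (simp add: X_def set_lebesgue_lebesgue_on scaleR_diff_right)
    also have "(\<integral>x. A x *v ?g x \<partial>?M) - (\<integral>x. A x0 *v ?g x \<partial>?M) = (\<integral>x. (A x - A x0) *v ?g x \<partial>?M)"
      using square_integrable_imp_integrable[OF fin est(2)] square_integrable_imp_integrable[OF fin sAg0]
      by (simp add: matrix_vector_mult_diff_rdistrib)
    finally have "norm (X \<rho> - A x0 *v \<xi>) = (1 / ?m) * norm (\<integral>x. (A x - A x0) *v ?g x \<partial>?M)"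
      by simp
    also have "\<dots> \<le> (1 / ?m) * (t / 2 * (K * ?m) + 1 / (2 * t) * (C * (\<integral>x. norm (A x - A x0) \<partial>?M)))"
    proof (intro mult_left_mono)
      have "norm (\<integral>x. (A x - A x0) *v ?g x \<partial>?M) \<le> (\<integral>x. norm (?g x) * norm (A x - A x0) \<partial>?M)"
      proof (rule order_trans[OF integral_norm_bound], rule integral_mono)
        show "integrable ?M (\<lambda>x. norm ((A x - A x0) *v ?g x))"
          using square_integrable_imp_integrable[OF fin est(2)] square_integrable_imp_integrable[OF fin sAg0]
          by (simp add: matrix_vector_mult_diff_rdistrib)
        show "norm ((A x - A x0) *v ?g x) \<le> norm (?g x) * norm (A x - A x0)" for x
          using norm_matrix_vector_mult_le[of "A x - A x0" "?g x"] by (simp add: mult.commute)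
      qed (rule square_integrable_pairing(1)[OF est(1) sA])
      \<comment> \<open>The factor \<open>t\<close> goes to the gradient, whose energy is merely
        bounded, and 1/t to the oscillation of \<open>A\<close>, whose mean vanishes in the
        limit.\<close>
      also have "\<dots> \<le> t / 2 * (\<integral>x. (norm (?g x))\<^sup>2 \<partial>?M) + 1 / (2 * t) * (\<integral>x. (norm (A x - A x0))\<^sup>2 \<partial>?M)"
        by (rule square_integrable_pairing(2)[OF est(1) sA t])
      also have "\<dots> \<le> t / 2 * (K * ?m) + 1 / (2 * t) * (C * (\<integral>x. norm (A x - A x0) \<partial>?M))"
      proof (intro add_mono mult_left_mono)
        show "(\<integral>x. (norm (?g x))\<^sup>2 \<partial>?M) \<le> K * ?m"
          using est(4) by (simp add: K_def)
        have "(\<integral>x. (norm (A x - A x0))\<^sup>2 \<partial>?M) \<le> (\<integral>x. C * norm (A x - A x0) \<partial>?M)"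
        proof (intro integral_mono_AE)
          show "integrable ?M (\<lambda>x. C * norm (A x - A x0))"
            by (intro integrable_mult_right integrable_norm square_integrable_imp_integrable[OF fin sA])
          \<comment> \<open>One of the two factors is bounded by \<open>C\<close>, which turns the
            quadratic oscillation into the first-power one controlled at a Lebesgue point.\<close>
          show "AE x in ?M. (norm (A x - A x0))\<^sup>2 \<le> C * norm (A x - A x0)"
            using AC by eventually_elim (simp add: power2_eq_square mult_right_mono)
        qed (rule square_integrableD(2)[OF sA])
        then show "(\<integral>x. (norm (A x - A x0))\<^sup>2 \<partial>?M) \<le> C * (\<integral>x. norm (A x - A x0) \<partial>?M)"
          by simp
      qed (use t in auto)
      finally show "norm (\<integral>x. (A x - A x0) *v ?g x \<partial>?M) \<le>
          t / 2 * (K * ?m) + 1 / (2 * t) * (C * (\<integral>x. norm (A x - A x0) \<partial>?M))" .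
    qed (use m in simp)
    also have "\<dots> = t * (K / 2) + C / 2 * Y \<rho> / t"
      using m t by (simp add: Y_def set_lebesgue_lebesgue_on field_simps)
    finally show ?thesis .
  qed
  \<comment> \<open>For each fixed \<open>t\<close> the bound holds for all \<rho> in (0, r), hence
    eventually as \<rho> tends to 0 from the right.\<close>
  have "((\<lambda>\<rho>. norm (X \<rho> - A x0 *v \<xi>)) \<longlongrightarrow> 0) (at_right 0)"
  proof (rule tendsto_0_if_weighted_bound)
    show "(Y \<longlongrightarrow> 0) (at_right 0)"
      using assms(6) unfolding lebesgue_point_def Y_def .
    fix t :: real assume t: "t > 0"
    have "\<forall>\<^sub>F \<rho> in at_right 0. \<rho> \<in> {0<..<r}"
      using r(1) by (rule eventually_at_right_real)
    then show "\<forall>\<^sub>F \<rho> in at_right 0. \<bar>norm (X \<rho> - A x0 *v \<xi>)\<bar> \<le> t * (K / 2) + C / 2 * Y \<rho> / t"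
      by eventually_elim (use bound[OF t] in auto)
  qed
  then have "(X \<longlongrightarrow> A x0 *v \<xi>) (at_right 0)"
    by (rule LIM_zero_cancel[OF tendsto_norm_zero_cancel])
  then show ?thesis
    unfolding X_def .
qed

end
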